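(* Suppose $P_{n,K}$ is full-dimensional. Let $Z\subset V$ be a set of size $|Z|\ge K+1$, write $|Z|=qK+r$ with $q\in\mathbb N$ and $r\in\{0,1,\dots,K-1\}$, let $U=V\setminus Z$, let $u_1$ be the smallest element of $U$ (if $U\neq\emptyset$) and let $z_{|Z|}$ be the largest element of $Z$. The general clique inequality $$\sum_{\{z,z'\}\subset Z,\,z<z'}x_{z,z'}\ge\binom{q+1}{2}r+\binom{q}{2}(K-r)$$ is facet-defining for $P_{n,K}$ if and only if: (i) $|U|\ge 1$ and $u_1\le 3$; (ii) $z_{|Z|}=n$; (iii) $|Z|\in\{K+1,\dots,2K-1\}$.
   Context: $V=\{1,\dots,n\}$ and $E$ is the set of all unordered pairs $ij$ of distinct elements of $V$; $x_{i,j}=x_{j,i}$. A $K$-partition $\pi$ is a collection of $K$ non-empty pairwise disjoint subsets (clusters) of $V$ whose union is $V$. The representative of a cluster is its smallest element. The characteristic vector $x^\pi\in\{0,1\}^{|E|+|V|-3}$ of $\pi$ has components $x_4,\dots,x_n$ and $x_{i,j}$ for $ij\in E$, where $x^\pi_{i,j}=1$ if $i,j$ are in the same cluster and $0$ otherwise, and $x^\pi_u=1$ if $u$ is the representative of its cluster and $0$ otherwise. (Representative variables of vertices $1,2,3$ are not coordinates.) $P_{n,K}\subset\mathbb R^{|E|+|V|-3}$ is the convex hull of the characteristic vectors $x^\pi$ of all $K$-partitions $\pi$ of $V$ (equivalently, of all $0/1$ solutions of the integer formulation of the $K$-partitioning problem). It is full-dimensional (dimension $|E|+|V|-3$) if and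 only if $K\in\{3,\dots,n-2\}$. An inequality is facet-defining for $P_{n,K}$ if it is valid for $P_{n,K}$ and the set of points of $P_{n,K}$ satisfying it with equality has dimension $\dim(P_{n,K})-1$. *)

theory Defs
  imports "HOL-Analysis.Analysis" "HOL-Analysis.Finite_Function_Topology" "HOL-Library.Disjoint_Sets"
begin

definition vertices :: "nat \<Rightarrow> nat set" where
  "vertices n = {1..n}"

definition edges :: "nat \<Rightarrow> nat set set" where
  "edges n = {{i, j} | i j. i \<in> vertices n \<and> j \<in> vertices n \<and> i \<noteq> j}"

text \<open>
  Coordinates are \<open>Rep u\<close> for the representative variable $x_u$ and \<open>Edge {i, j}\<close> for $x_{i,j}$;
  as the argument of \<open>Edge\<close> is a set, $x_{i,j} = x_{j,i}$ is built in.
\<close>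

datatype coord = Rep nat | Edge "nat set"

definition coords :: "nat \<Rightarrow> coord set" where
  "coords n = Rep ` {4..n} \<union> Edge ` edges n"

text \<open>
  Since \<open>n\<close> is a term and not a type, points are finitely supported functions \<open>coord \<Rightarrow>\<^sub>0 real\<close>.
  The space $R^{|E|+|V|-3}$ is the subspace of those supported in \<open>coords n\<close>.
\<close>

definition K_partition :: "nat \<Rightarrow> nat \<Rightarrow> nat set set \<Rightarrow> bool" where
  "K_partition n K \<pi> \<longleftrightarrow> partition_on (vertices n) \<pi> \<and> card \<pi> = K"

definition representative :: "nat set set \<Rightarrow> nat \<Rightarrow> bool" where
  "representative \<pi> u \<longleftrightarrow> (\<exists>C\<in>\<pi>. u = Min C)"

definition same_cluster :: "nat set set \<Rightarrow> nat set \<Rightarrow> bool" where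
  "same_cluster \<pi> e \<longleftrightarrow> (\<exists>C\<in>\<pi>. e \<subseteq> C)"

definition char_vec :: "nat \<Rightarrow> nat set set \<Rightarrow> (coord \<Rightarrow>\<^sub>0 real)" where
  "char_vec n \<pi> = Abs_poly_mapping (\<lambda>c.
     if c \<in> coords n
     then (case c of Rep u \<Rightarrow> of_bool (representative \<pi> u)
                   | Edge e \<Rightarrow> of_bool (same_cluster \<pi> e))
     else 0)"

definition partition_polytope :: "nat \<Rightarrow> nat \<Rightarrow> (coord \<Rightarrow>\<^sub>0 real) set" where
  "partition_polytope n K = convex hull (char_vec n ` {\<pi>. K_partition n K \<pi>})"

text \<open>
  The library's \<open>aff_dim\<close> requires a Euclidean space, which \<open>coord \<Rightarrow>\<^sub>0 real\<close> is not. The following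
  version works in every real vector space; \<open>affine_dim_eq_aff_dim\<close> below shows the agreement.
\<close>

definition affine_dim :: "'a::real_vector set \<Rightarrow> int" where
  "affine_dim S = (if S = {} then -1 else int (dim {x - y | x y. x \<in> S \<and> y \<in> S}))"

definition full_dimensional :: "nat \<Rightarrow> nat \<Rightarrow> bool" where
  "full_dimensional n K \<longleftrightarrow>
     affine_dim (partition_polytope n K) = int (card (edges n)) + int (card (vertices n)) - 3"

definition facet_defining :: "'a::real_vector set \<Rightarrow> ('a \<Rightarrow> real) \<Rightarrow> real \<Rightarrow> bool"
  \<comment> \<open>for the inequality \<open>f x \<ge> b\<close>\<close>
  where "facet_defining P f b \<longleftrightarrow>
     (\<forall>x\<in>P. f x \<ge> b) \<and> affine_dim {x \<in> P. f x = b} = affine_dim P - 1"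

definition clique_sum :: "nat set \<Rightarrow> (coord \<Rightarrow>\<^sub>0 real) \<Rightarrow> real" where
  "clique_sum Z x =
     (\<Sum>(z, z') \<in> {(z, z'). z \<in> Z \<and> z' \<in> Z \<and> z < z'}. Poly_Mapping.lookup x (Edge {z, z'}))"

definition clique_bound :: "nat \<Rightarrow> nat \<Rightarrow> nat \<Rightarrow> real" where
  "clique_bound K q r = real ((q + 1) choose 2) * real r + real (q choose 2) * (real K - real r)"

lemma finite_coords: "finite (coords n)"
proof -
  have "edges n \<subseteq> Pow (vertices n)"
    by (auto simp: edges_def)
  then have "finite (edges n)"
    by (rule finite_subset) (simp add: vertices_def)
  then show ?thesis
    by (simp add: coords_def)
qed

lemma lookup_char_vec:
  "Poly_Mapping.lookup (char_vec n \<pi>) c =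
     (if c \<in> coords n
      then (case c of Rep u \<Rightarrow> of_bool (representative \<pi> u)
                    | Edge e \<Rightarrow> of_bool (same_cluster \<pi> e))
      else 0)"
proof -
  let ?f = "\<lambda>c. if c \<in> coords n
      then (case c of Rep u \<Rightarrow> of_bool (representative \<pi> u)
                    | Edge e \<Rightarrow> of_bool (same_cluster \<pi> e))
      else (0 :: real)"
  have "finite {c. ?f c \<noteq> 0}"
    by (rule finite_subset[OF _ finite_coords[of n]]) auto
  then have "Poly_Mapping.lookup (Abs_poly_mapping ?f) = ?f"
    by (intro Abs_poly_mapping_inverse) (simp only: mem_Collect_eq)
  then show ?thesis
    unfolding char_vec_def by (rule fun_cong)
qed

lemma affine_dim_eq_aff_dim:
  fixes S :: "'a::euclidean_space set"
  shows "affine_dim S = aff_dim S"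
proof (cases "S = {}")
  case False
  then obtain a where a: "a \<in> S" by blast
  let ?D = "{x - y | x y. x \<in> S \<and> y \<in> S}" and ?T = "(+) (- a) ` S"
  have "?D \<subseteq> span ?T"
  proof clarify
    fix x y assume "x \<in> S" "y \<in> S"
    then have "(- a + x) - (- a + y) \<in> span ?T"
      by (intro span_diff span_base) auto
    then show "x - y \<in> span ?T" by simp
  qed
  moreover have "?T \<subseteq> span ?D"
  proof clarify
    fix x assume "x \<in> S"
    then have "x - a \<in> span ?D" using a by (intro span_base) auto
    then show "- a + x \<in> span ?D" by simp
  qed
  ultimately have "span ?D = span ?T"
    by (simp add: span_eq)
  then have "dim (span ?D) = dim (span ?T)"
    by (rule arg_cong)
  then have "dim ?D = dim ?T"
    unfolding dim_span .
  moreover have "aff_dim S = int (dim ?T)"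
    using a by (intro aff_dim_eq_dim) (simp add: hull_inc)
  ultimately show ?thesis
    using False by (simp add: affine_dim_def)
qed (simp add: affine_dim_def)

end

theory Submission
  imports Defs
begin

text \<open>
  A face of a full-dimensional polytope is a facet iff every linear functional that is constant on it
  is a multiple of the functional defining the face. By convexity of $m \mapsto {m \choose 2}$, the
  partitions on the face are those in which every cluster contains \<open>q\<close> or \<open>q + 1\<close> vertices of \<open>Z\<close>.

  If \<open>q \<ge> 2\<close> or \<open>n \<notin> Z\<close>, then \<open>n\<close> is never a representative on the face, so the coordinate $x_n$ is a
  constant functional. If \<open>q = 1\<close> and \<open>{1, 2, 3} \<subseteq> Z\<close>, no cluster contains all of \<open>1, 2, 3\<close>, and counting
  the \<open>K\<close> representatives shows that $\sum_{u \ge 4} x_u - x_{1,2} - x_{1,3} - x_{2,3}$ is constant.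

  Conversely, let \<open>a\<close> be the coefficients of a functional that is constant on the face, and take a vertex
  \<open>u \<le> 3\<close> outside \<open>Z\<close>. Moving \<open>u\<close> between a cluster with one and a cluster with two vertices of \<open>Z\<close>
  shows that all $a_v$ vanish; moving any other vertex outside \<open>Z\<close> in the same way shows that $a_{v,x} = 0$
  unless \<open>v, x \<in> Z\<close>; and exchanging $\{z, z'\}, \{y\}$ for $\{z, y\}, \{z'\}$ shows that the coefficients
  inside \<open>Z\<close> are equal.
\<close>

subsection \<open>Facets and linear functionals\<close>

text \<open>A basis of \<open>span S\<close> stays independent when \<open>v\<close> is added, so
  the values 0 on the basis and 1 at \<open>v\<close> extend linearly.\<close>

lemma vanishing_functional:
  fixes S :: "'a::real_vector set"
  assumes "v \<notin> span S"
  obtains g :: "'a \<Rightarrow> real" where "linear g" "\<And>x. x \<in> span S \<Longrightarrow> g x = 0" "g v = 1"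
proof -
  obtain B where B: "B \<subseteq> S" "independent B" "S \<subseteq> span B"
    by (rule basis_exists)
  then have eq: "span B = span S"
    by (simp add: span_eq span_superset span_mono subset_trans)
  then have ind: "independent (insert v B)"
    using B assms by (simp add: independent_insertI)
  obtain g :: "'a \<Rightarrow> real" where g: "linear g" "\<forall>x\<in>insert v B. g x = of_bool (x = v)"
    using linear_independent_extend[OF ind, of "\<lambda>x. of_bool (x = v)"] by blast
  have "v \<notin> B"
    using assms eq span_base by blast
  then have "g x = 0" if "x \<in> span S" for x
    using linear_eq_on_span[of g "\<lambda>x. 0" B x] g that eq
    by (force simp: module_hom_zero linear_iff)
  then show thesis
    using g by (intro that[of g]) auto
qed

text \<open>A functional constant on \<open>S\<close> vanishes on differences of points of
  \<open>S\<close>. If \<open>g p\<close> were nonzero, \<open>p\<close> would enlarge a basis of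
  the differences, whose dimension already is \<open>card E\<close>.\<close>

lemma affine_dim_eq_card_imp_functional_zero:
  fixes S E :: "'a::real_vector set" and g :: "'a \<Rightarrow> real"
  assumes E: "finite E" "independent E" and S: "S \<subseteq> span E"
    and dim: "affine_dim S = int (card E)"
    and g: "linear g" "\<And>x. x \<in> S \<Longrightarrow> g x = c" and p: "p \<in> span E"
  shows "g p = 0"
proof (rule ccontr)
  assume gp: "g p \<noteq> 0"
  define D where "D = {x - y | x y. x \<in> S \<and> y \<in> S}"
  have D: "D \<subseteq> span E"
    using S by (auto simp: D_def intro: span_diff)
  obtain T where T: "T \<subseteq> D" "independent T" "D \<subseteq> span T" "card T = dim D"
    by (rule basis_exists)
  have "g x = 0" if "x \<in> span T" for x
  proof (rule linear_eq_on_span[of g "\<lambda>x. 0" T x])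
    show "g x = 0" if "x \<in> T" for x
      using T(1) that g(2) by (auto simp: D_def linear_diff[OF g(1)])
  qed (use g that in \<open>auto simp: linear_iff\<close>)
  then have pT: "p \<notin> span T"
    using gp by blast
  then have ins: "independent (insert p T)" "insert p T \<subseteq> span E"
    using T D p by (simp add: independent_insertI, blast)
  have "finite (insert p T)" "card (insert p T) \<le> card E"
    using independent_span_bound[OF E(1) ins] by auto
  moreover have "p \<notin> T"
    using pT span_base by blast
  ultimately have "dim D < card E"
    using T(4) by simp
  then show False
    using dim by (auto simp: affine_dim_def D_def split: if_splits)
qed

text \<open>Being constant on \<open>S\<close> means vanishing on the differences of its points,
  which lie in the kernel of \<open>f\<close>. They have codimension one iff they span everything
  together with \<open>p\<close>, that is, iff such a functional is determined by its value at
  \<open>p\<close>.\<close>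

lemma affine_dim_hyperplane_iff:
  fixes S E :: "'a::real_vector set" and f :: "'a \<Rightarrow> real"
  assumes E: "finite E" "independent E" and S: "S \<subseteq> span E" "S \<noteq> {}"
    and f: "linear f" "\<And>x. x \<in> S \<Longrightarrow> f x = b" and p: "p \<in> span E" "f p \<noteq> 0"
  shows "affine_dim S = int (card E) - 1 \<longleftrightarrow>
    (\<forall>g c. linear g \<and> (\<forall>x\<in>S. g x = c) \<longrightarrow> (\<exists>k. \<forall>x\<in>span E. g x = k * f x))"
proof -
  define D where "D = {x - y | x y. x \<in> S \<and> y \<in> S}"
  have D: "D \<subseteq> span E"
    using S by (auto simp: D_def intro: span_diff)
  obtain T where T: "T \<subseteq> D" "independent T" "D \<subseteq> span T" "card T = dim D"
    by (rule basis_exists)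
  have vanish: "g x = 0" if g: "linear g" "\<And>x. x \<in> S \<Longrightarrow> g x = c" and x: "x \<in> span T"
    for g :: "'a \<Rightarrow> real" and c x
  proof (rule linear_eq_on_span[of g "\<lambda>x. 0" T x])
    show "g x = 0" if "x \<in> T" for x
      using T(1) that g(2) by (auto simp: D_def linear_diff[OF g(1)])
  qed (use g x in \<open>auto simp: linear_iff\<close>)
  have pT: "p \<notin> span T"
    using vanish[OF f, where x = p] p by blast
  have ins: "independent (insert p T)" "insert p T \<subseteq> span E"
    using T D p pT by (simp add: independent_insertI, blast)
  have fin: "finite (insert p T)" and le: "card (insert p T) \<le> card E"
    using independent_span_bound[OF E(1) ins] by auto
  have "p \<notin> T"
    using pT span_base by blast
  then have card_ins: "card (insert p T) = dim D + 1"
    using fin T(4) by simp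
  have affine: "affine_dim S = int (dim D)"
    using S by (simp add: affine_dim_def D_def)
  show ?thesis
  proof
    assume "affine_dim S = int (card E) - 1"
    then have card_eq: "card (insert p T) = card E"
      using card_ins affine by simp
    have spans: "span E \<subseteq> span (insert p T)"
    proof
      fix e assume e: "e \<in> span E"
      show "e \<in> span (insert p T)"
      proof (rule ccontr)
        assume no: "e \<notin> span (insert p T)"
        then have "independent (insert e (insert p T))" "insert e (insert p T) \<subseteq> span E"
          using ins e by (simp add: independent_insertI, blast)
        then have "card (insert e (insert p T)) \<le> card E"
          by (rule independent_span_bound[OF E(1), THEN conjunct2])
        moreover have "e \<notin> insert p T"
          using no span_base by blast
        ultimately show False
          using fin card_eq by simp
      qed
    qed
    show "\<forall>g c. linear g \<and> (\<forall>x\<in>S. g x = c) \<longrightarrow> (\<exists>k. \<forall>x\<in>span E. g x = k * f x)"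
    proof (intro allI impI exI ballI)
      fix g :: "'a \<Rightarrow> real" and c x
      assume g: "linear g \<and> (\<forall>x\<in>S. g x = c)" and x: "x \<in> span E"
      show "g x = g p / f p * f x"
      proof (rule linear_eq_on_span[of g "\<lambda>x. g p / f p * f x" "insert p T" x])
        show "linear (\<lambda>x. g p / f p * f x)"
          using f(1) by (simp add: linear_iff algebra_simps add_divide_distrib)
        show "g y = g p / f p * f y" if "y \<in> insert p T" for y
          using that vanish[of g c y] vanish[OF f, where x = y] g p span_base[of y T] by auto
      qed (use g x spans in auto)
    qed
  next
    assume H: "\<forall>g c. linear g \<and> (\<forall>x\<in>S. g x = c) \<longrightarrow> (\<exists>k. \<forall>x\<in>span E. g x = k * f x)"
    have "E \<subseteq> span (insert p T)"
    proof
      fix e assume e: "e \<in> E"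
      show "e \<in> span (insert p T)"
      proof (rule ccontr)
        assume "e \<notin> span (insert p T)"
        then obtain g :: "'a \<Rightarrow> real" where g: "linear g"
          "\<And>x. x \<in> span (insert p T) \<Longrightarrow> g x = 0" "g e = 1"
          by (rule vanishing_functional) blast
        obtain s where s: "s \<in> S"
          using S by blast
        have "g x = g s" if "x \<in> S" for x
        proof -
          have "x - s \<in> D"
            using that s by (auto simp: D_def)
          then have "x - s \<in> span (insert p T)"
            using T(3) span_mono[of T "insert p T"] by blast
          then show ?thesis
            using g(2)[of "x - s"] by (simp add: linear_diff[OF g(1)])
        qed
        then obtain k where k: "\<forall>x\<in>span E. g x = k * f x"
          using H g(1) by blast
        have "k * f p = 0"
          using k p g(2)[of p] by (simp add: span_base)
        then have "k = 0"
          using p by simp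
        then show False
          using k g(3) e by (simp add: span_base)
      qed
    qed
    then have "card E \<le> card (insert p T)"
      using independent_span_bound[OF fin E(2)] by blast
    then show "affine_dim S = int (card E) - 1"
      using le card_ins affine by simp
  qed
qed

lemma convex_hull_functional_ge:
  fixes f :: "'a::real_vector \<Rightarrow> real"
  assumes "linear f" "\<And>x. x \<in> S \<Longrightarrow> b \<le> f x" "x \<in> convex hull S"
  shows "b \<le> f x"
proof -
  have "convex {x. b \<le> f x}"
  proof (rule convexI)
    fix x y :: 'a and u v :: real
    assume xy: "x \<in> {x. b \<le> f x}" "y \<in> {x. b \<le> f x}" and uv: "0 \<le> u" "0 \<le> v" "u + v = 1"
    have "u * b + v * b \<le> u * f x + v * f y"
      using xy uv by (intro add_mono mult_left_mono) auto
    moreover have "u * b + v * b = b"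
      using uv(3) by (metis distrib_right mult_1)
    ultimately show "u *\<^sub>R x + v *\<^sub>R y \<in> {x. b \<le> f x}"
      using assms(1) by (simp add: linear_iff)
  qed
  then have "convex hull S \<subseteq> {x. b \<le> f x}"
    using assms(2) by (intro hull_minimal) auto
  then show ?thesis
    using assms(3) by blast
qed

text \<open>In a convex combination lying on the face the excesses \<open>f s - b\<close> are
  nonnegative and average to 0, so only points with \<open>f s = b\<close> carry weight.\<close>

lemma functional_constant_on_face:
  fixes f g :: "'a::real_vector \<Rightarrow> real"
  assumes S: "finite S" and f: "linear f" "\<And>s. s \<in> S \<Longrightarrow> b \<le> f s"
    and g: "linear g" "\<And>s. s \<in> S \<Longrightarrow> f s = b \<Longrightarrow> g s = c"
    and x: "x \<in> convex hull S" "f x = b"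
  shows "g x = c"
proof -
  obtain u where u: "\<And>s. s \<in> S \<Longrightarrow> 0 \<le> u s" "sum u S = 1" "x = (\<Sum>s\<in>S. u s *\<^sub>R s)"
    using x(1) by (auto simp: convex_hull_finite[OF S])
  have val: "h x - d = (\<Sum>s\<in>S. u s * (h s - d))" if "linear h" for h :: "'a \<Rightarrow> real" and d
    using that u(2) by (simp add: u(3) linear_sum linear_scale algebra_simps sum_subtractf
        flip: sum_distrib_left)
  have "(\<Sum>s\<in>S. u s * (f s - b)) = 0"
    using val[OF f(1), of b] x(2) by simp
  then have "\<forall>s\<in>S. u s * (f s - b) = 0"
    using u(1) f(2) S by (subst (asm) sum_nonneg_eq_0_iff) auto
  then have "\<forall>s\<in>S. u s * (g s - c) = 0"
    using g(2) by auto
  then have "(\<Sum>s\<in>S. u s * (g s - c)) = 0"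
    by (intro sum.neutral)
  then show ?thesis
    using val[OF g(1), of c] by simp
qed

subsection \<open>Coordinates and clusters\<close>

abbreviation unit_vec :: "'a \<Rightarrow> 'a \<Rightarrow>\<^sub>0 real" where
  "unit_vec c \<equiv> Poly_Mapping.single c 1"

lemma lookup_scaleR: "Poly_Mapping.lookup (r *\<^sub>R x) c = r * Poly_Mapping.lookup x c"
  for x :: "'a \<Rightarrow>\<^sub>0 real"
  by (simp add: scaleR_poly_mapping_def)

lemma linear_lookup: "linear (\<lambda>x :: 'a \<Rightarrow>\<^sub>0 real. Poly_Mapping.lookup x c)"
  by (simp add: linear_iff lookup_add lookup_scaleR)

lemma lookup_sum_unit_vec:
  assumes "finite C"
  shows "Poly_Mapping.lookup (\<Sum>c\<in>C. h c *\<^sub>R unit_vec c) d = (if d \<in> C then h d else 0)"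
proof -
  have "Poly_Mapping.lookup (\<Sum>c\<in>C. h c *\<^sub>R unit_vec c) d = (\<Sum>c\<in>C. h c * (if c = d then 1 else 0))"
    by (simp add: linear_sum[OF linear_lookup] lookup_scaleR lookup_single when_def)
  then show ?thesis
    using assms by (simp add: if_distrib cong: if_cong)
qed

lemma inj_unit_vec: "inj_on unit_vec C"
  by (rule inj_onI) (metis lookup_single_eq lookup_single_not_eq zero_neq_one)

lemma unit_vec_expansion:
  assumes "finite C" "\<And>c. c \<notin> C \<Longrightarrow> Poly_Mapping.lookup x c = 0"
  shows "x = (\<Sum>c\<in>C. Poly_Mapping.lookup x c *\<^sub>R unit_vec c)"
  using assms by (intro poly_mapping_eqI) (simp add: lookup_sum_unit_vec)

lemma independent_unit_vec:
  assumes C: "finite C"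
  shows "independent (unit_vec ` C)"
proof (rule independent_if_scalars_zero)
  fix h x assume 0: "(\<Sum>x\<in>unit_vec ` C. h x *\<^sub>R x) = 0" and "x \<in> unit_vec ` C"
  then obtain c where c: "c \<in> C" "x = unit_vec c"
    by blast
  have "(\<Sum>c\<in>C. h (unit_vec c) *\<^sub>R unit_vec c) = 0"
    using 0 by (simp add: sum.reindex[OF inj_unit_vec])
  then have "Poly_Mapping.lookup (\<Sum>c\<in>C. h (unit_vec c) *\<^sub>R unit_vec c) c = 0"
    by simp
  then show "h x = 0"
    using C c by (simp add: lookup_sum_unit_vec)
qed (use C in simp)

lemma in_span_unit_vec:
  assumes "finite C" "\<And>c. c \<notin> C \<Longrightarrow> Poly_Mapping.lookup x c = 0"
  shows "x \<in> span (unit_vec ` C)"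
  by (subst unit_vec_expansion[OF assms]) (simp_all add: span_sum span_scale span_base)

lemma linear_unit_vec_expansion:
  fixes g :: "('a \<Rightarrow>\<^sub>0 real) \<Rightarrow> real"
  assumes "linear g" "finite C" "\<And>c. c \<notin> C \<Longrightarrow> Poly_Mapping.lookup x c = 0"
  shows "g x = (\<Sum>c\<in>C. Poly_Mapping.lookup x c * g (unit_vec c))"
  by (subst unit_vec_expansion[OF assms(2,3)])
    (simp_all add: linear_sum[OF assms(1)] linear_scale[OF assms(1)])

definition pairs :: "'a set \<Rightarrow> 'a set set" where
  "pairs C = {e. e \<subseteq> C \<and> card e = 2}"

lemma finite_pairs: "finite C \<Longrightarrow> finite (pairs C)"
  by (auto simp: pairs_def intro: finite_subset[of _ "Pow C"])

lemma card_pairs: "finite C \<Longrightarrow> card (pairs C) = card C choose 2"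
  by (simp add: pairs_def n_subsets)

lemma doubleton_in_pairs_iff: "{i, j} \<in> pairs C \<longleftrightarrow> i \<in> C \<and> j \<in> C \<and> i \<noteq> j"
  by (auto simp: pairs_def card_insert_if)

lemma edges_eq_pairs: "edges n = pairs (vertices n)"
  by (auto simp: edges_def pairs_def card_2_iff)

lemma finite_edges: "finite (edges n)"
  by (simp add: edges_eq_pairs finite_pairs vertices_def)

text \<open>The bound on \<open>n\<close> matters: for \<open>n = 2\<close> there is one coordinate
  although the right-hand side is 0.\<close>

lemma card_coords: "3 \<le> n \<Longrightarrow> int (card (coords n)) = int (card (edges n)) + int (card (vertices n)) - 3"
  unfolding coords_def
  by (subst card_Un_disjoint) (auto simp: finite_edges card_image inj_on_def vertices_def)

lemma sum_coords:
  "(\<Sum>c\<in>coords n. h c) = (\<Sum>u\<in>{4..n}. h (Rep u)) + (\<Sum>e\<in>edges n. h (Edge e))"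
  unfolding coords_def
  by (subst sum.union_disjoint) (auto simp: finite_edges sum.reindex inj_on_def)

lemma Rep_in_coords_iff: "Rep u \<in> coords n \<longleftrightarrow> u \<in> {4..n}"
  by (auto simp: coords_def)

lemma Edge_in_coords_iff: "Edge e \<in> coords n \<longleftrightarrow> e \<in> edges n"
  by (auto simp: coords_def)

lemma char_vec_in_span: "char_vec n \<pi> \<in> span (unit_vec ` coords n)"
  by (rule in_span_unit_vec) (auto simp: finite_coords lookup_char_vec)

lemma linear_char_vec:
  fixes g :: "(coord \<Rightarrow>\<^sub>0 real) \<Rightarrow> real"
  assumes "linear g"
  shows "g (char_vec n \<pi>) =
    (\<Sum>u\<in>{4..n}. of_bool (representative \<pi> u) * g (unit_vec (Rep u))) +
    (\<Sum>e\<in>edges n. of_bool (same_cluster \<pi> e) * g (unit_vec (Edge e)))"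
proof -
  have "g (char_vec n \<pi>) =
      (\<Sum>c\<in>coords n. Poly_Mapping.lookup (char_vec n \<pi>) c * g (unit_vec c))"
    by (rule linear_unit_vec_expansion[OF assms finite_coords]) (simp add: lookup_char_vec)
  then show ?thesis
    by (simp only: sum_coords lookup_char_vec Rep_in_coords_iff Edge_in_coords_iff coord.case if_True
        cong: sum.cong)
qed

lemma sum_pairs_ordered:
  fixes Z :: "'a::linorder set"
  shows "(\<Sum>(z, z') \<in> {(z, z'). z \<in> Z \<and> z' \<in> Z \<and> z < z'}. h {z, z'}) = (\<Sum>e\<in>pairs Z. h e)"
proof -
  let ?O = "{(z, z'). z \<in> Z \<and> z' \<in> Z \<and> z < z'}"
  have "bij_betw (\<lambda>(z, z'). {z, z'}) ?O (pairs Z)"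
    unfolding bij_betw_def
  proof
    show "inj_on (\<lambda>(z, z'). {z, z'}) ?O"
      by (auto simp: inj_on_def doubleton_eq_iff)
    show "(\<lambda>(z, z'). {z, z'}) ` ?O = pairs Z"
      by (force simp: pairs_def card_2_iff image_iff insert_commute elim: linorder_neqE)
  qed
  from sum.reindex_bij_betw[OF this, of h] show ?thesis
    by (simp add: case_prod_unfold)
qed

lemma clique_sum_eq: "clique_sum Z x = (\<Sum>e\<in>pairs Z. Poly_Mapping.lookup x (Edge e))"
  unfolding clique_sum_def by (rule sum_pairs_ordered)

lemma linear_clique_sum: "linear (clique_sum Z)"
  by (simp add: linear_iff clique_sum_eq lookup_add lookup_scaleR sum.distrib sum_distrib_left)

section \<open>Clusters and their representatives\<close>

lemma cluster_subset: "K_partition n K \<pi> \<Longrightarrow> C \<in> \<pi> \<Longrightarrow> C \<subseteq> vertices n"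
  by (auto simp: K_partition_def partition_on_def)

lemma finite_cluster: "K_partition n K \<pi> \<Longrightarrow> C \<in> \<pi> \<Longrightarrow> finite C"
  by (drule (1) cluster_subset) (auto simp: vertices_def intro: finite_subset)

lemma cluster_nonempty: "K_partition n K \<pi> \<Longrightarrow> C \<in> \<pi> \<Longrightarrow> C \<noteq> {}"
  by (auto simp: K_partition_def partition_on_def)

lemma cluster_unique:
  "K_partition n K \<pi> \<Longrightarrow> C \<in> \<pi> \<Longrightarrow> D \<in> \<pi> \<Longrightarrow> v \<in> C \<Longrightarrow> v \<in> D \<Longrightarrow> C = D"
  unfolding K_partition_def partition_on_def pairwise_def disjnt_iff by metis

lemma in_some_cluster: "K_partition n K \<pi> \<Longrightarrow> v \<in> vertices n \<Longrightarrow> \<exists>C\<in>\<pi>. v \<in> C"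
  by (auto simp: K_partition_def partition_on_def)

lemma finite_partition: "K_partition n K \<pi> \<Longrightarrow> finite \<pi>"
  using finite_elements[of "vertices n" \<pi>] by (auto simp: K_partition_def vertices_def)

lemma finite_K_partitions: "finite {\<pi>. K_partition n K \<pi>}"
proof (rule finite_subset)
  show "{\<pi>. K_partition n K \<pi>} \<subseteq> Pow (Pow (vertices n))"
    using cluster_subset by blast
qed (simp add: vertices_def)

text \<open>An edge within a cluster lies in \<open>pairs C\<close> for exactly one
  \<open>C\<close>, so the edge part of a functional splits into contributions of single clusters;
  the exchange arguments rest on this.\<close>

lemma sum_same_cluster:
  fixes a :: "nat set \<Rightarrow> real"
  assumes P: "K_partition n K \<pi>"
  shows "(\<Sum>e\<in>edges n. of_bool (same_cluster \<pi> e) * a e) = (\<Sum>C\<in>\<pi>. \<Sum>e\<in>pairs C. a e)"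
proof -
  have "(\<Sum>e\<in>edges n. of_bool (same_cluster \<pi> e) * a e) = (\<Sum>e\<in>(\<Union>C\<in>\<pi>. pairs C). a e)"
    using cluster_subset[OF P]
    by (intro sum.mono_neutral_cong_right)
      (auto simp: finite_edges same_cluster_def, auto simp: edges_eq_pairs pairs_def)
  also have "\<dots> = (\<Sum>C\<in>\<pi>. \<Sum>e\<in>pairs C. a e)"
  proof (rule sum.UNION_disjoint)
    show "\<forall>C\<in>\<pi>. \<forall>D\<in>\<pi>. C \<noteq> D \<longrightarrow> pairs C \<inter> pairs D = {}"
    proof (intro ballI impI)
      fix C D assume "C \<in> \<pi>" "D \<in> \<pi>" "C \<noteq> D"
      then have "C \<inter> D = {}"
        using cluster_unique[OF P] by blast
      then show "pairs C \<inter> pairs D = {}"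
        by (auto simp: pairs_def card_2_iff)
    qed
  qed (use finite_partition[OF P] finite_cluster[OF P] finite_pairs in auto)
  finally show ?thesis .
qed

lemma inj_on_Min_clusters:
  assumes P: "K_partition n K \<pi>"
  shows "inj_on Min \<pi>"
proof (rule inj_onI)
  fix C D assume "C \<in> \<pi>" "D \<in> \<pi>" "Min C = Min D"
  then show "C = D"
    using Min_in[OF finite_cluster[OF P] cluster_nonempty[OF P]] cluster_unique[OF P] by metis
qed

lemma sum_representative:
  fixes w :: "nat \<Rightarrow> real"
  assumes P: "K_partition n K \<pi>" and A: "A \<subseteq> vertices n"
  shows "(\<Sum>u\<in>A. of_bool (representative \<pi> u) * w u) = (\<Sum>C\<in>\<pi>. of_bool (Min C \<in> A) * w (Min C))"
proof -
  have fin: "finite A"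
    using A by (rule finite_subset) (simp add: vertices_def)
  have "(\<Sum>u\<in>A. of_bool (representative \<pi> u) * w u) = (\<Sum>u\<in>Min ` \<pi>. of_bool (u \<in> A) * w u)"
    using fin finite_partition[OF P]
    by (intro sum.mono_neutral_cong) (auto simp: representative_def)
  then show ?thesis
    by (simp add: sum.reindex[OF inj_on_Min_clusters[OF P]])
qed

lemma sum_of_representatives:
  assumes P: "K_partition n K \<pi>"
  shows "(\<Sum>u\<in>vertices n. of_bool (representative \<pi> u)) = real K"
proof -
  have "Min C \<in> vertices n" if "C \<in> \<pi>" for C
    using Min_in[OF finite_cluster[OF P that] cluster_nonempty[OF P that]] cluster_subset[OF P that]
    by blast
  then have "(\<Sum>C\<in>\<pi>. of_bool (Min C \<in> vertices n) * 1) = real (card \<pi>)"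
    by simp
  then show ?thesis
    using sum_representative[OF P subset_refl, of "\<lambda>_. 1"] P by (simp add: K_partition_def)
qed

lemma representative_iff:
  assumes P: "K_partition n K \<pi>" and v: "v \<in> vertices n"
  shows "representative \<pi> v \<longleftrightarrow> (\<forall>w\<in>vertices n. w < v \<longrightarrow> \<not> same_cluster \<pi> {w, v})"
proof -
  obtain C where C: "C \<in> \<pi>" "v \<in> C"
    using in_some_cluster[OF P v] by blast
  have "same_cluster \<pi> {w, v} \<longleftrightarrow> w \<in> C" for w
    using C cluster_unique[OF P] by (auto simp: same_cluster_def)
  moreover have "representative \<pi> v \<longleftrightarrow> v = Min C"
  proof
    assume "representative \<pi> v"
    then obtain D where "D \<in> \<pi>" "v = Min D"
      by (auto simp: representative_def)
    then show "v = Min C"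
      using C Min_in[OF finite_cluster[OF P] cluster_nonempty[OF P], of D]
        cluster_unique[OF P, of C D v] by auto
  qed (use C in \<open>auto simp: representative_def\<close>)
  moreover have "v = Min C \<longleftrightarrow> (\<forall>w\<in>C. v \<le> w)"
    using C finite_cluster[OF P C(1)] by (metis Min_eqI Min_le)
  ultimately show ?thesis
    using cluster_subset[OF P C(1)] by (auto simp: not_less)
qed

lemma same_cluster_trans:
  assumes P: "K_partition n K \<pi>" and "same_cluster \<pi> {i, j}" "same_cluster \<pi> {j, k}"
  shows "same_cluster \<pi> {i, k}"
proof -
  obtain C D where "C \<in> \<pi>" "D \<in> \<pi>" "i \<in> C" "j \<in> C" "j \<in> D" "k \<in> D"
    using assms(2,3) by (auto simp: same_cluster_def)
  then show ?thesis
    using cluster_unique[OF P, of C D j] by (auto simp: same_cluster_def)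
qed

section \<open>The clique inequality and its equality case\<close>

lemma real_choose_two: "real (m choose 2) = real m * (real m - 1) / 2"
  by (induction m) (auto simp: numeral_2_eq_2 field_simps)

lemma card_eq_sum_clusters:
  assumes P: "K_partition n K \<pi>" and Z: "Z \<subseteq> vertices n"
  shows "card Z = (\<Sum>C\<in>\<pi>. card (C \<inter> Z))"
proof -
  have "card (\<Union>C\<in>\<pi>. C \<inter> Z) = (\<Sum>C\<in>\<pi>. card (C \<inter> Z))"
    using cluster_unique[OF P] finite_cluster[OF P] finite_partition[OF P]
    by (intro card_UN_disjoint) blast+
  moreover have "(\<Union>C\<in>\<pi>. C \<inter> Z) = Z"
    using in_some_cluster[OF P] Z by blast
  ultimately show ?thesis
    by simp
qed

text \<open>With \<open>m = card (C \<inter> Z)\<close>, the number of pairs is the excess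
  \<open>(m - q) * (m - q - 1) / 2\<close> plus \<open>q * m - q * (q + 1) / 2\<close>. As the
  \<open>m\<close> add up to \<open>card Z\<close>, the latter parts add up to the bound.\<close>

lemma clique_sum_char_vec:
  assumes P: "K_partition n K \<pi>" and Z: "Z \<subseteq> vertices n" and card: "card Z = q * K + r"
  shows "clique_sum Z (char_vec n \<pi>) = clique_bound K q r +
    (\<Sum>C\<in>\<pi>. (real (card (C \<inter> Z)) - real q) * (real (card (C \<inter> Z)) - real q - 1) / 2)"
proof -
  have "clique_sum Z (char_vec n \<pi>) = (\<Sum>e\<in>pairs Z. of_bool (same_cluster \<pi> e))"
    using Z unfolding clique_sum_eq
    by (intro sum.cong) (auto simp: lookup_char_vec coords_def edges_eq_pairs pairs_def)
  also have "\<dots> = (\<Sum>e\<in>edges n. of_bool (same_cluster \<pi> e) * of_bool (e \<subseteq> Z))"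
    using Z by (intro sum.mono_neutral_cong_left finite_edges) (auto simp: edges_eq_pairs pairs_def)
  also have "\<dots> = (\<Sum>C\<in>\<pi>. \<Sum>e\<in>pairs C. of_bool (e \<subseteq> Z))"
    by (rule sum_same_cluster[OF P])
  also have "\<dots> = (\<Sum>C\<in>\<pi>. real (card (C \<inter> Z) choose 2))"
  proof (rule sum.cong)
    fix C assume "C \<in> \<pi>"
    then have fin: "finite C"
      by (rule finite_cluster[OF P])
    have "(\<Sum>e\<in>pairs C. of_bool (e \<subseteq> Z)) = real (card (pairs (C \<inter> Z)))"
      using finite_pairs[OF fin] by (auto simp: pairs_def of_bool_def sum.If_cases intro!: arg_cong[of _ _ card])
    then show "(\<Sum>e\<in>pairs C. of_bool (e \<subseteq> Z)) = real (card (C \<inter> Z) choose 2)"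
      using fin by (simp add: card_pairs)
  qed simp
  also have "\<dots> = (\<Sum>C\<in>\<pi>. (real (card (C \<inter> Z)) - real q) * (real (card (C \<inter> Z)) - real q - 1) / 2
      + real q * real (card (C \<inter> Z)) - real q * (real q + 1) / 2)"
    by (intro sum.cong) (auto simp: real_choose_two field_simps)
  also have "\<dots> = (\<Sum>C\<in>\<pi>. (real (card (C \<inter> Z)) - real q) * (real (card (C \<inter> Z)) - real q - 1) / 2)
      + real q * real (card Z) - real K * (real q * (real q + 1) / 2)"
    using P by (simp add: sum.distrib sum_subtractf card_eq_sum_clusters[OF P Z] sum_distrib_left K_partition_def)
  moreover have "real q * real (card Z) - real K * (real q * (real q + 1) / 2) = clique_bound K q r"
    by (simp add: card clique_bound_def real_choose_two field_simps)
  ultimately show ?thesis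
    by (simp add: algebra_simps)
qed

text \<open>The factors are consecutive integers and hence never have opposite signs.\<close>

lemma clique_excess_nonneg: "0 \<le> (real m - real q) * (real m - real q - 1) / 2"
proof (cases "m \<le> q")
  case True
  then show ?thesis
    by (simp add: mult_nonpos_nonpos)
next
  case False
  then show ?thesis
    by (simp add: not_le Suc_le_eq)
qed

lemma clique_inequality_valid:
  assumes P: "K_partition n K \<pi>" and "Z \<subseteq> vertices n" "card Z = q * K + r"
  shows "clique_bound K q r \<le> clique_sum Z (char_vec n \<pi>)"
  unfolding clique_sum_char_vec[OF assms] using sum_nonneg[OF clique_excess_nonneg] by (simp only: le_add_same_cancel1)

lemma clique_inequality_tight_iff:
  assumes P: "K_partition n K \<pi>" and "Z \<subseteq> vertices n" "card Z = q * K + r"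
  shows "clique_sum Z (char_vec n \<pi>) = clique_bound K q r \<longleftrightarrow> (\<forall>C\<in>\<pi>. card (C \<inter> Z) \<in> {q, q + 1})"
proof -
  have "(real m - real q) * (real m - real q - 1) / 2 = 0 \<longleftrightarrow> m \<in> {q, q + 1}" for m
    by auto
  then show ?thesis
    unfolding clique_sum_char_vec[OF assms] add_cancel_left_right
    by (subst sum_nonneg_eq_0_iff[OF finite_partition[OF P] clique_excess_nonneg]) simp
qed

subsection \<open>Functionals constant on the face\<close>

lemma sum_pairs_insert:
  assumes "finite B" "v \<notin> B"
  shows "(\<Sum>e\<in>pairs (insert v B). a e) = (\<Sum>e\<in>pairs B. a e) + (\<Sum>b\<in>B. a {v, b})"
proof -
  have "pairs (insert v B) = pairs B \<union> (\<lambda>b. {v, b}) ` B"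
    using assms(2) by (auto simp: pairs_def card_2_iff)
  moreover have "pairs B \<inter> (\<lambda>b. {v, b}) ` B = {}"
    using assms(2) by (auto simp: pairs_def)
  moreover have "inj_on (\<lambda>b. {v, b}) B"
    using assms(2) by (auto simp: inj_on_def doubleton_eq_iff)
  ultimately show ?thesis
    using assms(1) by (simp add: sum.union_disjoint finite_pairs sum.reindex)
qed

lemma pairs_singleton: "pairs {x} = {}"
  by (auto simp: pairs_def dest: card_mono[rotated])

text \<open>Clusters are cut off one at a time, with \<open>q + 1\<close> vertices of
  \<open>Z\<close> while a surplus \<open>s\<close> remains and with \<open>q\<close> afterwards;
  the last one takes all that is left, including the vertices outside \<open>Z\<close>.\<close>

lemma balanced_partition_exists:
  assumes "finite A" "card (A \<inter> Z) = q * k + s" "s \<le> k" "1 \<le> k" "1 \<le> q"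
  shows "\<exists>\<pi>. partition_on A \<pi> \<and> card \<pi> = k \<and> (\<forall>C\<in>\<pi>. card (C \<inter> Z) \<in> {q, q + 1})"
  using assms(4,1-3)
proof (induction k arbitrary: A s rule: dec_induct)
  case base
  then have "card (A \<inter> Z) \<in> {q, q + 1}" "A \<noteq> {}"
    using assms(5) by auto
  then show ?case
    by (intro exI[of _ "{A}"]) (simp add: partition_on_space)
next
  case (step k)
  define t where "t = q + of_bool (s > 0)"
  have "t \<le> card (A \<inter> Z)"
    using step.prems by (auto simp: t_def)
  then obtain C where C: "C \<subseteq> A \<inter> Z" "card C = t" "finite C"
    using obtain_subset_with_card_n by metis
  have CZ: "C \<inter> Z = C" "(A - C) \<inter> Z = A \<inter> Z - C"
    using C by auto
  \<comment> \<open>For \<open>s = 0\<close> the truncated \<open>s - 1\<close> is again 0.\<close>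
  have "card ((A - C) \<inter> Z) = q * k + (s - 1)"
    using C step.prems by (auto simp: CZ card_Diff_subset t_def)
  moreover have "finite (A - C)" "s - 1 \<le> k"
    using step.prems by auto
  ultimately obtain \<pi> where \<pi>: "partition_on (A - C) \<pi>" "card \<pi> = k"
      "\<forall>D\<in>\<pi>. card (D \<inter> Z) \<in> {q, q + 1}"
    using step.IH[of "A - C" "s - 1"] by blast
  have "C \<noteq> {}"
    using C(2) assms(5) by (auto simp: t_def)
  moreover have "disjnt C (\<Union>\<pi>)"
    using partition_onD1[OF \<pi>(1)] by (auto simp: disjnt_def)
  moreover from this have "C \<notin> \<pi>"
    using \<open>C \<noteq> {}\<close> by (auto simp: disjnt_def)
  moreover have "finite \<pi>"
    using finite_elements[OF _ \<pi>(1)] step.prems by simp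
  ultimately show ?case
    using \<pi> C CZ by (intro exI[of _ "insert C \<pi>"]) (auto simp: partition_on_insert t_def)
qed

section \<open>Coefficients of a functional constant on the face, for q = 1\<close>

text \<open>\<open>w\<close> and \<open>a\<close> are the coefficients at representative and edge
  variables, and \<open>\<beta>\<close> is the constant value. Weights up to 3 are 0 because those
  variables are not coordinates. The bounds on \<open>r\<close> ensure that clusters with one and
  clusters with two vertices of \<open>Z\<close> both occur.\<close>

locale tight_functional =
  fixes n K r u :: nat and Z :: "nat set"
    and w :: "nat \<Rightarrow> real" and a :: "nat set \<Rightarrow> real" and \<beta> :: real
  assumes Z: "Z \<subseteq> vertices n" "card Z = K + r" and K: "3 \<le> K" and r: "1 \<le> r" "r < K"
    and u: "u \<in> vertices n - Z" "u \<le> 3" and n: "n \<in> Z"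
    and w: "\<And>v. v \<le> 3 \<Longrightarrow> w v = 0"
    and tight: "\<And>\<pi>. K_partition n K \<pi> \<Longrightarrow> \<forall>C\<in>\<pi>. card (C \<inter> Z) \<in> {1, 2} \<Longrightarrow>
      (\<Sum>C\<in>\<pi>. w (Min C) + (\<Sum>e\<in>pairs C. a e)) = \<beta>"
begin

text \<open>The contribution of one cluster to the functional, which makes local changes of a
  partition comparable.\<close>

definition val :: "nat set \<Rightarrow> real" where
  "val C = w (Min C) + (\<Sum>e\<in>pairs C. a e)"

definition good :: "nat set \<Rightarrow> bool" where
  "good C \<longleftrightarrow> C \<subseteq> vertices n \<and> card (C \<inter> Z) \<in> {1, 2}"

lemma good_finite: "good C \<Longrightarrow> finite C"
  by (auto simp: good_def vertices_def intro: finite_subset)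

lemma good_nonempty: "good C \<Longrightarrow> C \<noteq> {}"
  by (auto simp: good_def)

lemma finite_Z: "finite Z"
  using Z(1) by (rule finite_subset) (simp add: vertices_def)

lemma card_Z: "4 \<le> card Z"
  using Z K r by simp

lemma n_ge: "4 \<le> n"
  using card_Z card_mono[OF _ Z(1)] by (simp add: vertices_def)

text \<open>\<open>Z\<close> has at least four vertices, since \<open>3 \<le> K\<close> and
  \<open>1 \<le> r\<close>; this supplies the auxiliary vertices below.\<close>

lemma obtain_in_Z:
  assumes "finite B" "card B \<le> 3"
  obtains z where "z \<in> Z" "z \<notin> B"
proof -
  have "\<not> Z \<subseteq> B"
    using card_mono[OF assms(1), of Z] assms(2) card_Z by auto
  then show thesis
    using that by blast
qed

lemma good_single: "z \<in> Z \<Longrightarrow> good {z}"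
  using Z by (auto simp: good_def)

lemma good_pair: "z \<in> Z \<Longrightarrow> y \<in> vertices n \<Longrightarrow> good {y, z}"
  using Z by (cases "y \<in> Z") (auto simp: good_def Int_insert_left card_insert_if)

lemma good_insert: "v \<in> vertices n - Z \<Longrightarrow> good (insert v C) \<longleftrightarrow> good C"
  by (auto simp: good_def)

text \<open>Two clusters with three vertices of \<open>Z\<close> can be completed to a partition satisfying the clique
  inequality with equality, and the completion depends only on their union.\<close>

lemma exchange:
  assumes good: "good C" "good D" "good C'" "good D'"
    and disj: "C \<inter> D = {}" "C' \<inter> D' = {}" and un: "C \<union> D = C' \<union> D'"
    and card3: "card ((C \<union> D) \<inter> Z) = 3"
  shows "val C + val D = val C' + val D'"
proof -
  define A where "A = vertices n - (C \<union> D)"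
  have "finite A"
    by (simp add: A_def vertices_def)
  moreover have "A \<inter> Z = Z - (C \<union> D) \<inter> Z"
    using Z by (auto simp: A_def)
  \<comment> \<open>Three vertices of \<open>Z\<close> are used up; the other \<open>K - 2\<close>
    clusters share the remaining \<open>K + r - 3\<close>.\<close>
  then have "card (A \<inter> Z) = 1 * (K - 2) + (r - 1)"
    using Z K r card3 finite_Z by (simp add: card_Diff_subset)
  moreover have "r - 1 \<le> K - 2" "1 \<le> K - 2"
    using K r by auto
  ultimately obtain R where R: "partition_on A R" "card R = K - 2" "\<forall>C\<in>R. card (C \<inter> Z) \<in> {1, 2}"
    using balanced_partition_exists[of A Z 1 "K - 2" "r - 1"] by (auto simp: numeral_2_eq_2)
  have finR: "finite R"
    using finite_elements[OF \<open>finite A\<close> R(1)] .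
  \<comment> \<open>The completion \<open>R\<close> is the same for every splitting of the union, so
    its value cancels.\<close>
  have "val E + val F = \<beta> - sum val R"
    if E: "good E" "good F" "E \<inter> F = {}" "E \<union> F = C \<union> D" for E F
  proof -
    have A: "vertices n - F - E = A" "\<Union>R = A"
      using E partition_onD1[OF R(1)] by (auto simp: A_def)
    have "partition_on (vertices n - F) (insert E R)"
      using E A R(1) good_nonempty[OF E(1)]
      by (subst partition_on_insert) (auto simp: disjnt_iff A_def good_def)
    then have "partition_on (vertices n) (insert F (insert E R))"
      using E A good_nonempty[OF E(2)]
      by (subst partition_on_insert) (auto simp: disjnt_iff A_def good_def)
    moreover have notin: "E \<notin> R" "F \<notin> insert E R"
      using E A(2) good_nonempty[OF E(1)] good_nonempty[OF E(2)] unfolding A_def by blast+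
    ultimately have "K_partition n K (insert F (insert E R))"
      using R(2) K finR by (simp add: K_partition_def)
    then have "(\<Sum>C\<in>insert F (insert E R). val C) = \<beta>"
      unfolding val_def using R(3) E by (intro tight) (auto simp: good_def)
    then show ?thesis
      using notin finR by simp
  qed
  from this[of C D] this[of C' D'] show ?thesis
    using assms by simp
qed

lemma val_insert:
  assumes "finite B" "B \<noteq> {}" "v \<notin> B"
  shows "val (insert v B) - val B = w (min v (Min B)) - w (Min B) + (\<Sum>b\<in>B. a {v, b})"
  using assms by (simp add: val_def sum_pairs_insert)

text \<open>By \<open>exchange\<close>, two disjoint good clusters with three vertices of
  \<open>Z\<close> in all gain the same by receiving \<open>v\<close>. Chains of such comparisons
  link every good cluster to \<open>{n}\<close>.\<close>

lemma insertion_constant: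
  assumes v: "v \<in> vertices n - Z"
  obtains \<gamma> where "\<And>B. good B \<Longrightarrow> v \<notin> B \<Longrightarrow> val (insert v B) - val B = \<gamma>"
proof -
  define G where "G B = val (insert v B) - val B" for B
  have eq: "G B = G D"
    if "good B" "good D" "v \<notin> B" "v \<notin> D" "B \<inter> D = {}" "card (B \<inter> Z) + card (D \<inter> Z) = 3" for B D
  proof -
    have "val (insert v B) + val D = val B + val (insert v D)"
    proof (rule exchange)
      have "(insert v B \<union> D) \<inter> Z = (B \<inter> Z) \<union> (D \<inter> Z)"
        using v by auto
      moreover have "card ((B \<inter> Z) \<union> (D \<inter> Z)) = card (B \<inter> Z) + card (D \<inter> Z)"
        using that finite_Z by (intro card_Un_disjoint) auto
      ultimately show "card ((insert v B \<union> D) \<inter> Z) = 3"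
        using that by simp
    qed (use that v in \<open>auto simp: good_insert\<close>)
    then show ?thesis
      by (simp add: G_def)
  qed
  have pair_eq: "G B = G {p, q}"
    if B: "good B" "v \<notin> B" "card (B \<inter> Z) = 1" and pq: "p \<in> Z" "q \<in> Z" "p \<noteq> q" "p \<notin> B" "q \<notin> B"
    for B p q
  proof (rule eq)
    show "good {p, q}"
      using pq Z by (auto intro: good_pair)
    have "{p, q} \<inter> Z = {p, q}"
      using pq by auto
    then show "card (B \<inter> Z) + card ({p, q} \<inter> Z) = 3"
      using B pq by simp
  qed (use B pq v in auto)
  \<comment> \<open>Two singletons have too few vertices for a direct comparison, so both are
    compared with a common pair \<open>{p, q}\<close>.\<close>
  have single: "G {z} = G {n}" if z: "z \<in> Z" for z
  proof -
    obtain p where p: "p \<in> Z" "p \<notin> {z, n}"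
      by (rule obtain_in_Z[of "{z, n}"]) (auto simp: card_insert_if)
    obtain q where q: "q \<in> Z" "q \<notin> {z, n, p}"
      by (rule obtain_in_Z[of "{z, n, p}"]) (auto simp: card_insert_if)
    have "G {z'} = G {p, q}" if "z' \<in> {z, n}" for z'
      using p q z n v that by (intro pair_eq) (auto intro: good_single simp: Int_insert_left)
    then show ?thesis
      by simp
  qed
  have two: "G B = G {n}" if B: "good B" "v \<notin> B" "card (B \<inter> Z) = 2" for B
  proof -
    obtain z where z: "z \<in> Z" "z \<notin> B \<inter> Z"
      by (rule obtain_in_Z[of "B \<inter> Z"]) (use B finite_Z in auto)
    then have "G B = G {z}"
      using B v by (intro eq) (auto intro: good_single simp: Int_insert_left)
    then show ?thesis
      using single[OF z(1)] by simp
  qed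
  have "G B = G {n}" if B: "good B" "v \<notin> B" for B
  proof (cases "card (B \<inter> Z) = 2")
    case False
    then have one: "card (B \<inter> Z) = 1"
      using B by (auto simp: good_def)
    obtain p where p: "p \<in> Z" "p \<notin> B \<inter> Z"
      by (rule obtain_in_Z[of "B \<inter> Z"]) (use one finite_Z in auto)
    obtain q where q: "q \<in> Z" "q \<notin> insert p (B \<inter> Z)"
      by (rule obtain_in_Z[of "insert p (B \<inter> Z)"]) (use one finite_Z p in auto)
    have "G B = G {p, q}"
      using B one p q by (intro pair_eq) auto
    also have "\<dots> = G {n}"
      using p q v Z by (intro two) (auto intro: good_pair simp: Int_insert_left)
    finally show ?thesis .
  qed (use B two in blast)
  then show thesis
    using that by (simp add: G_def)
qed

text \<open>The vertex \<open>u\<close> makes the representative of its cluster at most \<open>3\<close>, which has weight \<open>0\<close>; moving \<open>u\<close>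
  therefore isolates the weight of the representative of the cluster it leaves or joins.\<close>

lemma weights_vanish:
  assumes v: "v \<in> vertices n"
  shows "w v = 0"
proof -
  \<comment> \<open>The smallest vertex other than \<open>u\<close>, hence the minimum of every
    cluster that contains it but not \<open>u\<close>.\<close>
  define m where "m = (if u = 1 then 2 else 1 :: nat)"
  have u1: "1 \<le> u"
    using u by (simp add: vertices_def)
  have m: "m \<in> vertices n" "m \<noteq> u" "m < 3"
    using n_ge by (auto simp: m_def vertices_def)
  have m_less: "m < x" if "x \<in> vertices n - {u, m}" for x
    using that by (auto simp: m_def vertices_def split: if_splits)
  obtain \<gamma> where \<gamma>: "\<And>B. good B \<Longrightarrow> u \<notin> B \<Longrightarrow> val (insert u B) - val B = \<gamma>"
    by (rule insertion_constant[OF u(1)]) blast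
  \<comment> \<open>After \<open>u\<close> has joined, the representative has weight 0, so only the
    weight of \<open>Min B\<close> remains.\<close>
  have link: "(\<Sum>b\<in>B. a {u, b}) = \<gamma> + w (Min B)" if B: "good B" "u \<notin> B" for B
  proof -
    have "w (min u (Min B)) = 0"
      using u by (intro w) simp
    then show ?thesis
      using \<gamma>[OF B] val_insert[OF good_finite[OF B(1)] good_nonempty[OF B(1)] B(2)] by simp
  qed
  \<comment> \<open>Two clusters with minimum \<open>m\<close> that differ only in \<open>x\<close>
    are compared through \<open>link\<close>; the weights cancel.\<close>
  have edge: "a {u, x} = 0" if x: "x \<in> vertices n - {u, m}" for x
  proof -
    \<comment> \<open>Taking \<open>z = m\<close> when \<open>m\<close> lies in \<open>Z\<close>
      keeps \<open>{x, m, z}\<close> at no more than two vertices of \<open>Z\<close>.\<close>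
    obtain z where z: "z \<in> Z" "z \<noteq> x" "m \<in> Z \<longrightarrow> z = m"
    proof (cases "m \<in> Z")
      case True
      then show thesis
        using that x by blast
    next
      case False
      obtain z where "z \<in> Z" "z \<notin> {x}"
        by (rule obtain_in_Z[of "{x}"]) auto
      then show thesis
        using that False by blast
    qed
    define B where "B = {m, z}"
    have zu: "z \<noteq> u" "z \<in> vertices n"
      using z u Z by auto
    have good: "good B" "good (insert x B)"
    proof -
      show "good B"
        using z m by (auto simp: B_def intro: good_pair)
      have "{x, m, z} \<inter> Z = {x, z} \<inter> Z"
        using z by auto
      then show "good (insert x B)"
        using good_pair[of z x] z x m zu by (auto simp: B_def good_def)
    qed
    have min: "Min B = m" "Min (insert x B) = m"
      using m_less[of x] m_less[of z] zu x by (cases "z = m"; auto simp: B_def min_def)+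
    have "u \<notin> insert x B" "x \<notin> B" "finite B"
      using x z m zu by (auto simp: B_def)
    then show ?thesis
      using link[OF good(1)] link[OF good(2)] min by simp
  qed
  \<comment> \<open>The edges from \<open>u\<close> to \<open>{x, n}\<close> vanish, so
    \<open>link\<close> leaves only the weight of the minimum \<open>x\<close>.\<close>
  have weight: "w x = - \<gamma>" if x: "x \<in> vertices n - {u, m}" for x
  proof -
    have nn: "n \<in> vertices n - {u, m}"
      using n u Z n_ge m by auto
    have "Min {x, n} = x"
      using x by (auto simp: vertices_def min_def)
    moreover have "good {x, n}" "u \<notin> {x, n}"
      using n x nn by (auto intro: good_pair)
    moreover have "(\<Sum>b\<in>{x, n}. a {u, b}) = 0"
      using edge x nn by (intro sum.neutral) auto
    ultimately show ?thesis
      using link[of "{x, n}"] by simp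
  qed
  \<comment> \<open>The third vertex among 1, 2, 3 has weight 0 and weight
    \<open>- \<gamma>\<close>.\<close>
  obtain y where "y \<in> vertices n - {u, m}" "y \<le> 3"
  proof -
    have "\<exists>y\<in>{1, 2, 3 :: nat}. y \<noteq> u \<and> y \<noteq> m"
      by (auto simp: m_def)
    then show thesis
      using that[of 1] that[of 2] that[of 3] n_ge by (auto simp: vertices_def)
  qed
  then have "\<gamma> = 0"
    using weight[of y] w[of y] by simp
  then show ?thesis
    using weight[of v] w[of v] v u m by (cases "v \<in> {u, m}") auto
qed

lemma val_eq: "good C \<Longrightarrow> val C = (\<Sum>e\<in>pairs C. a e)"
  using Min_in[OF good_finite good_nonempty] weights_vanish by (auto simp: val_def good_def)

text \<open>Once the weights are 0, the edges from \<open>v\<close> to any good cluster have the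
  same sum; \<open>{z}\<close> is compared with \<open>{x, z}\<close>.\<close>

lemma edges_outside_vanish:
  assumes v: "v \<in> vertices n - Z" and x: "x \<in> vertices n" "x \<noteq> v"
  shows "a {v, x} = 0"
proof -
  obtain \<gamma> where \<gamma>: "\<And>B. good B \<Longrightarrow> v \<notin> B \<Longrightarrow> val (insert v B) - val B = \<gamma>"
    by (rule insertion_constant[OF v]) blast
  have link: "(\<Sum>b\<in>B. a {v, b}) = \<gamma>" if B: "good B" "v \<notin> B" for B
    using \<gamma>[OF B] B v by (simp add: val_eq good_insert sum_pairs_insert good_finite)
  have Zv: "a {v, z} = \<gamma>" if "z \<in> Z" for z
    using link[of "{z}"] good_single[OF that] v that by auto
  obtain z where z: "z \<in> Z" "z \<notin> {x}"
    by (rule obtain_in_Z[of "{x}"]) auto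
  have "a {v, x} + a {v, z} = \<gamma>"
    using link[of "{x, z}"] good_pair[OF z(1) x(1)] x z v by auto
  then show ?thesis
    using Zv[OF z(1)] by simp
qed

text \<open>Exchanging \<open>{y, z}, {y'}\<close> for \<open>{y', z}, {y}\<close> settles edges
  with a common endpoint; the general case passes through \<open>{x, p}\<close>.\<close>

lemma edges_inside_equal:
  assumes "x \<in> Z" "y \<in> Z" "x \<noteq> y" "p \<in> Z" "q \<in> Z" "p \<noteq> q"
  shows "a {x, y} = a {p, q}"
proof -
  have step: "a {z, y} = a {z, y'}" if z: "z \<in> Z" "y \<in> Z" "y' \<in> Z" "y \<noteq> z" "y' \<noteq> z" for z y y'
  proof (cases "y = y'")
    case False
    have "val {y, z} + val {y'} = val {y', z} + val {y}"
    proof (rule exchange)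
      have "({y, z} \<union> {y'}) \<inter> Z = {y, z, y'}"
        using z by auto
      then show "card (({y, z} \<union> {y'}) \<inter> Z) = 3"
        using z False by simp
    qed (use z Z False in \<open>auto intro!: good_pair good_single\<close>)
    moreover have "good {y, z}" "good {y', z}" "good {y}" "good {y'}"
      using z Z by (auto intro!: good_pair good_single)
    moreover have "pairs {y, z} = {{y, z}}" "pairs {y', z} = {{y', z}}"
      using z by (auto simp: pairs_def card_2_iff)
    ultimately show ?thesis
      by (simp add: val_eq pairs_singleton insert_commute)
  qed simp
  show ?thesis
  proof (cases "x = p")
    case True
    then show ?thesis
      using step[of p y q] assms by auto
  next
    case False
    then have "a {x, y} = a {x, p}"
      using step[of x y p] assms by auto
    also have "\<dots> = a {p, q}"
      using step[of p x q] False assms by (auto simp: insert_commute)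
    finally show ?thesis .
  qed
qed

text \<open>These are the edge coefficients of \<open>k\<close> times \<open>clique_sum Z\<close>,
  with \<open>k\<close> the common value inside \<open>Z\<close>.\<close>

lemma edge_weights:
  obtains k where "\<And>e. e \<in> edges n \<Longrightarrow> a e = k * of_bool (e \<in> pairs Z)"
proof -
  obtain p where p: "p \<in> Z" "p \<notin> {}"
    by (rule obtain_in_Z[of "{}"]) auto
  obtain q where q: "q \<in> Z" "q \<notin> {p}"
    by (rule obtain_in_Z[of "{p}"]) auto
  have "a e = a {p, q} * of_bool (e \<in> pairs Z)" if e: "e \<in> edges n" for e
  proof -
    obtain x y where xy: "e = {x, y}" "x \<in> vertices n" "y \<in> vertices n" "x \<noteq> y"
      using e by (auto simp: edges_def)
    show ?thesis
    proof (cases "x \<in> Z \<and> y \<in> Z")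
      case True
      then show ?thesis
        using edges_inside_equal[of x y p q] p q xy by (simp add: doubleton_in_pairs_iff)
    next
      case False
      then show ?thesis
        using edges_outside_vanish[of x y] edges_outside_vanish[of y x] xy
        by (auto simp: doubleton_in_pairs_iff insert_commute)
    qed
  qed
  then show thesis
    by (rule that)
qed

end

subsection \<open>The facet criterion\<close>

definition balanced :: "nat \<Rightarrow> nat \<Rightarrow> nat set \<Rightarrow> nat \<Rightarrow> nat set set \<Rightarrow> bool" where
  "balanced n K Z q \<pi> \<longleftrightarrow> K_partition n K \<pi> \<and> (\<forall>C\<in>\<pi>. card (C \<inter> Z) \<in> {q, q + 1})"

lemma partition_polytope_in_span: "partition_polytope n K \<subseteq> span (unit_vec ` coords n)"
  unfolding partition_polytope_def
  by (rule hull_minimal) (auto simp: char_vec_in_span subspace_imp_convex)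

lemma card_unit_vec: "card (unit_vec ` A) = card A"
  by (rule card_image[OF inj_unit_vec])

lemma clique_sum_unit_vec_Edge: "finite Z \<Longrightarrow> clique_sum Z (unit_vec (Edge e)) = of_bool (e \<in> pairs Z)"
  by (simp add: clique_sum_eq lookup_single when_def finite_pairs cong: if_cong)

lemma clique_sum_unit_vec_Rep: "clique_sum Z (unit_vec (Rep u)) = 0"
  by (simp add: clique_sum_eq lookup_single when_def)

lemma linear_zero_functional: "linear (\<lambda>x. 0 :: real)"
  by (simp add: linear_iff)

text \<open>A linear functional is constant on the face iff it is constant on the characteristic
  vectors there, which are those of balanced partitions. This carries
  \<open>affine_dim_hyperplane_iff\<close> over to partitions; the existence part says that the face
  is nonempty.\<close>

lemma facet_defining_clique_iff:
  assumes n: "3 \<le> n" and full: "full_dimensional n K" and Z: "Z \<subseteq> vertices n" "2 \<le> card Z"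
    and card: "card Z = q * K + r"
  shows "facet_defining (partition_polytope n K) (clique_sum Z) (clique_bound K q r) \<longleftrightarrow>
    (\<exists>\<pi>. balanced n K Z q \<pi>) \<and>
    (\<forall>g c. linear g \<and> (\<forall>\<pi>. balanced n K Z q \<pi> \<longrightarrow> g (char_vec n \<pi>) = c) \<longrightarrow>
      (\<exists>k. \<forall>x\<in>span (unit_vec ` coords n). g x = k * clique_sum Z x))"
    (is "_ \<longleftrightarrow> ?ex \<and> ?uniq")
proof -
  let ?P = "partition_polytope n K" and ?f = "clique_sum Z" and ?b = "clique_bound K q r"
  let ?E = "unit_vec ` coords n" and ?V = "char_vec n ` {\<pi>. K_partition n K \<pi>}"
  let ?F = "{x \<in> ?P. ?f x = ?b}"
  have finZ: "finite Z"
    using Z(1) by (rule finite_subset) (simp add: vertices_def)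
  have tight: "?f (char_vec n \<pi>) = ?b \<longleftrightarrow> balanced n K Z q \<pi>" if "K_partition n K \<pi>" for \<pi>
    using clique_inequality_tight_iff[OF that Z(1) card] that by (simp add: balanced_def)
  have valid: "?b \<le> ?f s" if "s \<in> ?V" for s
    using that clique_inequality_valid[OF _ Z(1) card] by blast
  have dimP: "affine_dim ?P = int (card ?E)"
    using full n by (simp add: full_dimensional_def card_coords card_unit_vec)
  have face: "(\<forall>x\<in>?F. g x = c) \<longleftrightarrow> (\<forall>\<pi>. balanced n K Z q \<pi> \<longrightarrow> g (char_vec n \<pi>) = c)"
    if g: "linear g" for g :: "_ \<Rightarrow> real" and c
  proof
    assume L: "\<forall>x\<in>?F. g x = c"
    show "\<forall>\<pi>. balanced n K Z q \<pi> \<longrightarrow> g (char_vec n \<pi>) = c"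
    proof (intro allI impI)
      fix \<pi> assume \<pi>: "balanced n K Z q \<pi>"
      then have K: "K_partition n K \<pi>"
        by (simp add: balanced_def)
      then have "char_vec n \<pi> \<in> ?P"
        by (auto simp: partition_polytope_def intro: hull_inc)
      then show "g (char_vec n \<pi>) = c"
        using L tight[OF K] \<pi> by simp
    qed
  next
    assume R: "\<forall>\<pi>. balanced n K Z q \<pi> \<longrightarrow> g (char_vec n \<pi>) = c"
    show "\<forall>x\<in>?F. g x = c"
    proof
      fix x assume x: "x \<in> ?F"
      show "g x = c"
      proof (rule functional_constant_on_face[OF _ linear_clique_sum valid g])
        show "g s = c" if "s \<in> ?V" "?f s = ?b" for s
          using that tight R by auto
      qed (use x finite_K_partitions in \<open>auto simp: partition_polytope_def\<close>)
    qed
  qed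
  have valid_P: "\<forall>x\<in>?P. ?b \<le> ?f x"
    using convex_hull_functional_ge[OF linear_clique_sum valid]
    by (auto simp: partition_polytope_def)
  \<comment> \<open>The zero functional equals 1 throughout the face only if the face is
    empty.\<close>
  have ne: "?F \<noteq> {} \<longleftrightarrow> ?ex"
    using face[OF linear_zero_functional, of 1] by auto
  obtain e where e: "e \<subseteq> Z" "card e = 2"
    using obtain_subset_with_card_n[OF Z(2)] by metis
  then have e_in: "unit_vec (Edge e) \<in> ?E" "?f (unit_vec (Edge e)) \<noteq> 0"
    using Z finZ by (auto simp: coords_def edges_eq_pairs pairs_def clique_sum_unit_vec_Edge)
  have "facet_defining ?P ?f ?b \<longleftrightarrow> affine_dim ?F = int (card ?E) - 1"
    using valid_P dimP by (simp add: facet_defining_def)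
  also have "\<dots> \<longleftrightarrow> ?F \<noteq> {} \<and> affine_dim ?F = int (card ?E) - 1"
  proof -
    \<comment> \<open>An empty face has dimension -1, which would require that there be no
      coordinates.\<close>
    have "card ?E \<noteq> 0"
      using e_in finite_coords by (auto simp: card_eq_0_iff)
    then show ?thesis
      by (auto simp: affine_dim_def)
  qed
  also have "\<dots> \<longleftrightarrow> ?F \<noteq> {} \<and> ?uniq"
  proof (rule conj_cong[OF refl])
    assume "?F \<noteq> {}"
    then have "affine_dim ?F = int (card ?E) - 1 \<longleftrightarrow>
        (\<forall>g c. linear g \<and> (\<forall>x\<in>?F. g x = c) \<longrightarrow> (\<exists>k. \<forall>x\<in>span ?E. g x = k * ?f x))"
      using partition_polytope_in_span e_in finite_coords
      by (intro affine_dim_hyperplane_iff[OF _ _ _ _ linear_clique_sum, where b = ?b and p = "unit_vec (Edge e)"])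
        (auto simp: independent_unit_vec intro: span_base)
    also have "\<dots> \<longleftrightarrow> ?uniq"
      using face by blast
    finally show "affine_dim ?F = int (card ?E) - 1 \<longleftrightarrow> ?uniq" .
  qed
  finally show ?thesis
    using ne by simp
qed

section \<open>Representatives and the vertices 1, 2, 3\<close>

text \<open>Of the \<open>K\<close> representatives those up to 3 are subtracted: 1 always is one, 2
  unless it is together with 1, and 3 unless it is together with 1 or 2.\<close>

lemma sum_high_representatives:
  assumes P: "K_partition n K \<pi>" and n: "3 \<le> n"
  shows "(\<Sum>u\<in>{4..n}. of_bool (representative \<pi> u)) = real K - 1 - of_bool (\<not> same_cluster \<pi> {1, 2})
    - of_bool (\<not> same_cluster \<pi> {1, 3} \<and> \<not> same_cluster \<pi> {2, 3})"
proof -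
  have V: "vertices n = {1, 2, 3} \<union> {4..n}"
    using n by (auto simp: vertices_def)
  have "(\<Sum>u\<in>vertices n. of_bool (representative \<pi> u) :: real) =
      (\<Sum>u\<in>{1, 2, 3}. of_bool (representative \<pi> u)) + (\<Sum>u\<in>{4..n}. of_bool (representative \<pi> u))"
    unfolding V by (rule sum.union_disjoint) auto
  moreover have "representative \<pi> 1"
    using n by (subst representative_iff[OF P]) (auto simp: vertices_def)
  moreover have "representative \<pi> 2 \<longleftrightarrow> \<not> same_cluster \<pi> {1, 2}"
  proof (subst representative_iff[OF P])
    have "w \<in> vertices n \<and> w < 2 \<longleftrightarrow> w = 1" for w
      using n by (auto simp: vertices_def)
    then show "(\<forall>w\<in>vertices n. w < 2 \<longrightarrow> \<not> same_cluster \<pi> {w, 2}) \<longleftrightarrow> \<not> same_cluster \<pi> {1, 2}"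
      by metis
  qed (use n in \<open>simp add: vertices_def\<close>)
  moreover have "representative \<pi> 3 \<longleftrightarrow> \<not> same_cluster \<pi> {1, 3} \<and> \<not> same_cluster \<pi> {2, 3}"
  proof (subst representative_iff[OF P])
    have "w \<in> vertices n \<and> w < 3 \<longleftrightarrow> w = 1 \<or> w = 2" for w
      using n by (auto simp: vertices_def)
    then show "(\<forall>w\<in>vertices n. w < 3 \<longrightarrow> \<not> same_cluster \<pi> {w, 3}) \<longleftrightarrow>
        \<not> same_cluster \<pi> {1, 3} \<and> \<not> same_cluster \<pi> {2, 3}"
      by metis
  qed (use n in \<open>simp add: vertices_def\<close>)
  ultimately show ?thesis
    by (simp add: sum_of_representatives[OF P])
qed

text \<open>Transitivity excludes that exactly two of the three pairs are joined; the five cases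
  left correspond to the partitions of a three-element set.\<close>

lemma same_cluster_triangle:
  fixes i j k :: nat
  assumes "K_partition n K \<pi>"
  defines "p \<equiv> same_cluster \<pi> {i, j}" and "q \<equiv> same_cluster \<pi> {i, k}" and "s \<equiv> same_cluster \<pi> {j, k}"
  shows "p \<and> q \<and> s \<or> p \<and> \<not> q \<and> \<not> s \<or> \<not> p \<and> q \<and> \<not> s \<or> \<not> p \<and> \<not> q \<and> s \<or> \<not> p \<and> \<not> q \<and> \<not> s"
proof -
  have "p \<Longrightarrow> q \<Longrightarrow> s" "p \<Longrightarrow> s \<Longrightarrow> q" "q \<Longrightarrow> s \<Longrightarrow> p"
    using same_cluster_trans[OF assms(1)] unfolding p_def q_def s_def by (metis insert_commute)+
  then show ?thesis
    by blast
qed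

text \<open>On characteristic vectors this depends only on how the clusters split \<open>{1, 2, 3}\<close>, because exactly
  \<open>K\<close> vertices are representatives. It is constant for \<open>t = 1/2\<close> if \<open>K \<le> 2\<close>, and for \<open>t = 1\<close> if no cluster
  contains \<open>{1, 2, 3}\<close>.\<close>

definition low_functional :: "nat \<Rightarrow> real \<Rightarrow> (coord \<Rightarrow>\<^sub>0 real) \<Rightarrow> real" where
  "low_functional n t x = (\<Sum>u\<in>{4..n}. Poly_Mapping.lookup x (Rep u)) -
    t * (\<Sum>e\<in>{{1, 2}, {1, 3}, {2, 3}}. Poly_Mapping.lookup x (Edge e))"

lemma linear_low_functional: "linear (low_functional n t)"
  by (simp add: linear_iff low_functional_def lookup_add lookup_scaleR sum.distrib
      sum_distrib_left algebra_simps)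

lemma triangle_edges_distinct: "{1, 2} \<noteq> {1, 3 :: nat}" "{1, 2} \<noteq> {2, 3 :: nat}" "{1, 3} \<noteq> {2, 3 :: nat}"
  by (auto simp: doubleton_eq_iff)

lemma low_functional_char_vec:
  assumes P: "K_partition n K \<pi>" and n: "3 \<le> n"
  shows "low_functional n t (char_vec n \<pi>) = real K - 1 - of_bool (\<not> same_cluster \<pi> {1, 2})
    - of_bool (\<not> same_cluster \<pi> {1, 3} \<and> \<not> same_cluster \<pi> {2, 3})
    - t * (of_bool (same_cluster \<pi> {1, 2}) + of_bool (same_cluster \<pi> {1, 3})
      + of_bool (same_cluster \<pi> {2, 3}))"
proof -
  have Rep: "(\<Sum>u\<in>{4..n}. Poly_Mapping.lookup (char_vec n \<pi>) (Rep u)) =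
      (\<Sum>u\<in>{4..n}. of_bool (representative \<pi> u))"
    by (intro sum.cong) (auto simp: lookup_char_vec Rep_in_coords_iff)
  have "{1, 2} \<in> edges n" "{1, 3} \<in> edges n" "{2, 3} \<in> edges n"
    using n by (auto simp: edges_eq_pairs doubleton_in_pairs_iff vertices_def)
  then have "low_functional n t (char_vec n \<pi>) = (\<Sum>u\<in>{4..n}. of_bool (representative \<pi> u))
    - t * (of_bool (same_cluster \<pi> {1, 2}) + of_bool (same_cluster \<pi> {1, 3})
      + of_bool (same_cluster \<pi> {2, 3}))"
    using triangle_edges_distinct Rep
    by (simp add: low_functional_def lookup_char_vec Edge_in_coords_iff)
  then show ?thesis
    by (simp only: sum_high_representatives[OF P n])
qed

text \<open>For \<open>K \<le> 2\<close> two of the vertices 1, 2, 3 share a cluster, and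
  \<open>low_functional n (1/2)\<close> is constant on the polytope. Full dimension would force its
  coefficients to vanish.\<close>

lemma full_dimensional_imp_ge_3:
  assumes n: "3 \<le> n" and full: "full_dimensional n K"
  shows "3 \<le> K"
proof (rule ccontr)
  assume K: "\<not> 3 \<le> K"
  let ?g = "low_functional n (1/2)"
  have const: "?g (char_vec n \<pi>) = real K - 5/2" if P: "K_partition n K \<pi>" for \<pi>
  proof -
    \<comment> \<open>With 1, 2, 3 in three different clusters this count would be
      \<open>K - 3\<close>, which is negative.\<close>
    have "0 \<le> (\<Sum>u\<in>{4..n}. of_bool (representative \<pi> u) :: real)"
      by (simp add: sum_nonneg)
    then have "\<not> (\<not> same_cluster \<pi> {1, 2} \<and> \<not> same_cluster \<pi> {1, 3} \<and> \<not> same_cluster \<pi> {2, 3})"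
      using K unfolding sum_high_representatives[OF P n] by (intro notI) simp
    then show ?thesis
      using same_cluster_triangle[OF P, of 1 2 3] unfolding low_functional_char_vec[OF P n]
      by (elim disjE) simp_all
  qed
  have "?g (unit_vec (Edge {1, 2})) = 0"
  proof (rule affine_dim_eq_card_imp_functional_zero[OF _ _ partition_polytope_in_span _ linear_low_functional])
    show "affine_dim (partition_polytope n K) = int (card (unit_vec ` coords n))"
      using full n by (simp add: full_dimensional_def card_coords card_unit_vec)
    show "?g x = real K - 5/2" if "x \<in> partition_polytope n K" for x
    \<comment> \<open>For the zero functional and bound 0 the face is the whole polytope.\<close>
    proof (rule functional_constant_on_face[OF _ linear_zero_functional _ linear_low_functional, where b = 0])
      show "x \<in> convex hull char_vec n ` {\<pi>. K_partition n K \<pi>}"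
        using that by (simp add: partition_polytope_def)
    qed (use const finite_K_partitions in auto)
    show "unit_vec (Edge {1, 2}) \<in> span (unit_vec ` coords n)"
      using n by (intro span_base imageI)
        (simp add: Edge_in_coords_iff edges_eq_pairs doubleton_in_pairs_iff vertices_def)
  qed (auto simp: finite_coords independent_unit_vec)
  then show False
    using triangle_edges_distinct by (simp add: low_functional_def lookup_single when_def)
qed

section \<open>Necessity of the conditions\<close>

text \<open>Multiples of \<open>clique_sum Z\<close> have coefficient 0 at all representative
  variables. If a condition fails, some functional constant on the face has a nonzero coefficient
  there.\<close>

lemma facet_imp_conditions:
  assumes n: "3 \<le> n" and full: "full_dimensional n K" and Z: "Z \<subseteq> vertices n" "K + 1 \<le> card Z"
    and card: "card Z = q * K + r" "r < K"
    and facet: "facet_defining (partition_polytope n K) (clique_sum Z) (clique_bound K q r)"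
  shows "\<not> {1, 2, 3} \<subseteq> Z" "n \<in> Z" "q = 1"
proof -
  have K: "3 \<le> K"
    using full_dimensional_imp_ge_3[OF n full] .
  have n4: "4 \<le> n"
    using card_mono[OF _ Z(1)] Z K by (simp add: vertices_def)
  have q: "1 \<le> q"
    using Z card by (cases q) auto
  have unique: "\<exists>k. \<forall>x\<in>span (unit_vec ` coords n). g x = k * clique_sum Z x"
    if g: "linear g" "\<And>\<pi>. balanced n K Z q \<pi> \<Longrightarrow> g (char_vec n \<pi>) = c" for g :: "_ \<Rightarrow> real" and c
  proof -
    have "2 \<le> card Z"
      using Z K by simp
    from facet_defining_clique_iff[OF n full Z(1) this card(1)] facet g show ?thesis
      by blast
  qed
  have Rep_zero: "g (unit_vec (Rep u)) = 0"
    if g: "linear g" "\<And>\<pi>. balanced n K Z q \<pi> \<Longrightarrow> g (char_vec n \<pi>) = c" and u: "u \<in> {4..n}"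
    for g :: "_ \<Rightarrow> real" and c u
  proof -
    obtain k where "\<forall>x\<in>span (unit_vec ` coords n). g x = k * clique_sum Z x"
      using unique[OF g] by blast
    moreover have "unit_vec (Rep u) \<in> span (unit_vec ` coords n)"
      using u by (intro span_base imageI) (simp add: Rep_in_coords_iff)
    ultimately show ?thesis
      by (simp add: clique_sum_unit_vec_Rep)
  qed
  have "\<exists>\<pi>. balanced n K Z q \<pi> \<and> representative \<pi> n"
  proof (rule ccontr)
    assume no: "\<not> ?thesis"
    have "Poly_Mapping.lookup (unit_vec (Rep n)) (Rep n) = (0 :: real)"
      by (rule Rep_zero[OF linear_lookup, where c = 0])
        (use n4 no in \<open>auto simp: lookup_char_vec\<close>)
    then show False
      by simp
  qed
  then obtain \<pi> C where \<pi>: "K_partition n K \<pi>" "C \<in> \<pi>" "n = Min C" "card (C \<inter> Z) \<in> {q, q + 1}"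
    by (auto simp: balanced_def representative_def)
  \<comment> \<open>As \<open>n\<close> is the largest vertex, its cluster is \<open>{n}\<close>;
    meeting \<open>Z\<close> in at least \<open>q \<ge> 1\<close> vertices forces
    \<open>n \<in> Z\<close> and \<open>q = 1\<close>.\<close>
  have "n \<le> v \<and> v \<le> n" if "v \<in> C" for v
    using that \<pi>(3) Min_le[OF finite_cluster[OF \<pi>(1,2)] that] cluster_subset[OF \<pi>(1,2)]
    by (auto simp: vertices_def)
  then have "C \<subseteq> {n}"
    by (auto intro: antisym)
  then have sub: "C \<inter> Z \<subseteq> {n} \<inter> Z"
    by blast
  then have "card (C \<inter> Z) \<le> card ({n} \<inter> Z)"
    by (intro card_mono) auto
  then show "n \<in> Z" "q = 1"
    using \<pi>(4) q by (cases "n \<in> Z"; auto)+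
  show "\<not> {1, 2, 3} \<subseteq> Z"
  proof
    assume low: "{1, 2, 3} \<subseteq> Z"
    have "low_functional n 1 (char_vec n \<pi>) = real K - 3" if \<pi>: "balanced n K Z q \<pi>" for \<pi>
    proof -
      have P: "K_partition n K \<pi>"
        using \<pi> by (simp add: balanced_def)
      \<comment> \<open>A cluster with 1, 2 and 3 would contain three vertices of \<open>Z\<close>,
        exceeding \<open>q + 1 = 2\<close>.\<close>
      have "\<not> (same_cluster \<pi> {1, 2} \<and> same_cluster \<pi> {1, 3})"
      proof
        assume "same_cluster \<pi> {1, 2} \<and> same_cluster \<pi> {1, 3}"
        then obtain C D where CD: "C \<in> \<pi>" "D \<in> \<pi>" "{1, 2} \<subseteq> C" "{1, 3} \<subseteq> D"
          by (auto simp: same_cluster_def)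
        then have "C = D"
          using cluster_unique[OF P, of C D 1] by simp
        then have "card {1, 2, 3 :: nat} \<le> card (C \<inter> Z)"
          using CD low finite_cluster[OF P CD(1)] by (intro card_mono) auto
        then show False
          using \<pi> CD(1) \<open>q = 1\<close> by (auto simp: balanced_def)
      qed
      then show ?thesis
        using same_cluster_triangle[OF P, of 1 2 3] unfolding low_functional_char_vec[OF P n]
        by (elim disjE) simp_all
    qed
    from Rep_zero[OF linear_low_functional this, of 4] n4 show False
      by (simp add: low_functional_def lookup_single when_def cong: if_cong)
  qed
qed

section \<open>Sufficiency of the conditions\<close>

lemma conditions_imp_facet:
  assumes n: "3 \<le> n" and full: "full_dimensional n K" and Z: "Z \<subseteq> vertices n"
    and card: "card Z = K + r" "1 \<le> r" "r < K"
    and nZ: "n \<in> Z" and u: "u \<in> vertices n - Z" "u \<le> 3"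
  shows "facet_defining (partition_polytope n K) (clique_sum Z) (clique_bound K 1 r)"
proof (subst facet_defining_clique_iff[OF n full Z])
  have K: "3 \<le> K"
    using full_dimensional_imp_ge_3[OF n full] .
  have finZ: "finite Z"
    using Z by (rule finite_subset) (simp add: vertices_def)
  show "2 \<le> card Z" "card Z = 1 * K + r"
    using card K by auto
  have "vertices n \<inter> Z = Z" "finite (vertices n)"
    using Z by (auto simp: vertices_def)
  then have "\<exists>\<pi>. balanced n K Z 1 \<pi>"
    using balanced_partition_exists[of "vertices n" Z 1 K r] card K
    by (simp add: balanced_def K_partition_def conj_assoc)
  moreover have "\<exists>k. \<forall>x\<in>span (unit_vec ` coords n). g x = k * clique_sum Z x"
    if g: "linear g" "\<forall>\<pi>. balanced n K Z 1 \<pi> \<longrightarrow> g (char_vec n \<pi>) = c" for g :: "_ \<Rightarrow> real" and c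
  proof -
    \<comment> \<open>Extension by 0 to the vertices 1, 2, 3 lets every cluster contribute the
      weight of its minimum.\<close>
    define w where "w v = (if v \<in> {4..n} then g (unit_vec (Rep v)) else 0)" for v
    define a where "a e = g (unit_vec (Edge e))" for e
    have expand: "g (char_vec n \<pi>) = (\<Sum>C\<in>\<pi>. w (Min C) + (\<Sum>e\<in>pairs C. a e))"
      if P: "K_partition n K \<pi>" for \<pi>
    proof -
      have "(\<Sum>u\<in>{4..n}. of_bool (representative \<pi> u) * w u) = (\<Sum>C\<in>\<pi>. of_bool (Min C \<in> {4..n}) * w (Min C))"
        by (rule sum_representative[OF P]) (auto simp: vertices_def)
      also have "\<dots> = (\<Sum>C\<in>\<pi>. w (Min C))"
        by (intro sum.cong) (auto simp: w_def)
      moreover have "(\<Sum>u\<in>{4..n}. of_bool (representative \<pi> u) * w u) =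
          (\<Sum>u\<in>{4..n}. of_bool (representative \<pi> u) * g (unit_vec (Rep u)))"
        by (intro sum.cong) (auto simp: w_def)
      ultimately show ?thesis
        using sum_same_cluster[OF P, of a]
        unfolding linear_char_vec[OF g(1)] sum.distrib a_def by simp
    qed
    interpret tight_functional n K r u Z w a c
    proof
      show "(\<Sum>C\<in>\<pi>. w (Min C) + (\<Sum>e\<in>pairs C. a e)) = c"
        if P: "K_partition n K \<pi>" and "\<forall>C\<in>\<pi>. card (C \<inter> Z) \<in> {1, 2}" for \<pi>
        using that g(2) expand[OF P] by (auto simp: balanced_def numeral_2_eq_2)
    qed (use Z card K u nZ in \<open>auto simp: w_def\<close>)
    obtain k where k: "\<And>e. e \<in> edges n \<Longrightarrow> a e = k * of_bool (e \<in> pairs Z)"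
      using edge_weights by blast
    have "g x = k * clique_sum Z x" if x: "x \<in> span (unit_vec ` coords n)" for x
    proof (rule linear_eq_on_span[OF g(1) _ _ x])
      show "linear (\<lambda>x. k * clique_sum Z x)"
        using linear_clique_sum[of Z] by (simp add: linear_iff algebra_simps)
      fix y assume "y \<in> unit_vec ` coords n"
      then consider v where "v \<in> {4..n}" "y = unit_vec (Rep v)"
        | e where "e \<in> edges n" "y = unit_vec (Edge e)"
        by (auto simp: coords_def)
      then show "g y = k * clique_sum Z y"
      proof cases
        case 1
        then show ?thesis
          using weights_vanish[of v] by (simp add: w_def clique_sum_unit_vec_Rep vertices_def)
      next
        case 2
        then show ?thesis
          using k[of e] finZ by (simp add: a_def clique_sum_unit_vec_Edge)
      qed
    qed
    then show ?thesis
      by blast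
  qed
  ultimately show "(\<exists>\<pi>. balanced n K Z 1 \<pi>) \<and>
    (\<forall>g c. linear g \<and> (\<forall>\<pi>. balanced n K Z 1 \<pi> \<longrightarrow> g (char_vec n \<pi>) = c) \<longrightarrow>
      (\<exists>k. \<forall>x\<in>span (unit_vec ` coords n). g x = k * clique_sum Z x))"
    by blast
qed

section \<open>Small vertex sets and the final equivalence\<close>

text \<open>Otherwise there are no edges and the required dimension is at most -2, but
  \<open>affine_dim\<close> is at least -1.\<close>

lemma full_dimensional_imp_ge_2:
  assumes "full_dimensional n K"
  shows "2 \<le> n"
proof (rule ccontr)
  assume "\<not> 2 \<le> n"
  then have "n = 0 \<or> n = 1"
    by auto
  then have "vertices n \<subseteq> {1}"
    by (auto simp: vertices_def)
  then have "edges n = {}" "card (vertices n) \<le> 1"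
    using card_mono[of "{1}" "vertices n"] by (auto simp: edges_def)
  then show False
    using assms by (auto simp: full_dimensional_def affine_dim_def split: if_splits)
qed

text \<open>For \<open>n = 2\<close> the number $|E|+|V|-3$ is \<open>0\<close> although there is one coordinate, so the one-point
  polytope for \<open>K = 1\<close> counts as \<open>full_dimensional\<close> and has to be treated separately.\<close>

lemma not_facet_two_vertices:
  assumes full: "full_dimensional 2 K" and Z: "Z \<subseteq> vertices 2" "K + 1 \<le> card Z"
    and card: "card Z = q * K + r" "r < K"
  shows "\<not> facet_defining (partition_polytope 2 K) (clique_sum Z) (clique_bound K q r)"
proof
  assume facet: "facet_defining (partition_polytope 2 K) (clique_sum Z) (clique_bound K q r)"
  have V: "vertices 2 = {1, 2}"
    by (auto simp: vertices_def)
  have "card Z \<le> 2"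
    using card_mono[OF _ Z(1)] by (simp add: V)
  then have K: "K = 1" and cZ: "card Z = 2"
    using Z card by auto
  then have "Z = vertices 2"
    using Z by (intro card_subset_eq) (auto simp: V)
  have P: "K_partition 2 K {vertices 2}"
    using K by (auto simp: K_partition_def V intro: partition_on_space)
  have "clique_sum Z (char_vec 2 {vertices 2}) = clique_bound K q r"
    using clique_inequality_tight_iff[OF P Z(1) card(1)] \<open>Z = vertices 2\<close> cZ card K by auto
  moreover have "char_vec 2 {vertices 2} \<in> partition_polytope 2 K"
    using P by (auto simp: partition_polytope_def intro: hull_inc)
  \<comment> \<open>A nonempty face has dimension at least 0, but a facet of this 0-dimensional
    polytope would have dimension -1.\<close>
  ultimately have "{x \<in> partition_polytope 2 K. clique_sum Z x = clique_bound K q r} \<noteq> {}"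
    by blast
  moreover have "card (edges 2) = 1"
    unfolding edges_eq_pairs V by (simp add: card_pairs choose_two)
  then have "affine_dim (partition_polytope 2 K) = 0"
    using full by (simp add: full_dimensional_def V)
  ultimately show False
    using facet by (auto simp: facet_defining_def affine_dim_def split: if_splits)
qed

theorem theorem7p1:
  fixes n K q r :: nat and Z U :: "nat set"
  assumes "full_dimensional n K"
    and "Z \<subseteq> vertices n"
    and "card Z \<ge> K + 1"
    and "card Z = q * K + r" and "r < K"
    and "U = vertices n - Z"
  shows "facet_defining (partition_polytope n K) (clique_sum Z) (clique_bound K q r) \<longleftrightarrow>
           (card U \<ge> 1 \<and> Min U \<le> 3) \<and> Max Z = n \<and> card Z \<in> {K + 1..2 * K - 1}"
proof (cases "n = 2")
  case True
  \<comment> \<open>From \<open>r < K\<close> follows \<open>K \<ge> 1\<close>, so \<open>Z\<close>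
    has at least two elements and leaves nothing for \<open>U\<close>; both sides of the equivalence
    are false.\<close>
  have "card Z = card (vertices n)"
    using assms(2-5) card_mono[OF _ assms(2)] True by (auto simp: vertices_def)
  then have "U = {}"
    using assms(2,6) card_subset_eq[of "vertices n" Z] by (auto simp: vertices_def)
  then show ?thesis
    using not_facet_two_vertices[of K Z q r] assms(1-5) True by simp
next
  case False
  then have n: "3 \<le> n"
    using full_dimensional_imp_ge_2[OF assms(1)] by simp
  have finZ: "finite Z" and finU: "finite U"
    using assms(2,6) finite_subset[of Z "vertices n"] by (auto simp: vertices_def)
  have neZ: "Z \<noteq> {}"
    using assms(3) by auto
  show ?thesis
  proof
    assume facet: "facet_defining (partition_polytope n K) (clique_sum Z) (clique_bound K q r)"
    note cond = facet_imp_conditions[OF n assms(1-5) facet]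
    obtain v where v: "v \<in> U" "v \<le> 3"
      using that[of 1] that[of 2] that[of 3] cond(1) n assms(6) by (auto simp: vertices_def)
    then have "1 \<le> card U"
      using finU by (auto simp: Suc_le_eq card_gt_0_iff)
    moreover have "Min U \<le> 3"
      using Min_le[OF finU v(1)] v(2) by simp
    moreover have "Max Z = n"
      using cond(2) assms(2) finZ by (intro Max_eqI) (auto simp: vertices_def)
    ultimately show "(card U \<ge> 1 \<and> Min U \<le> 3) \<and> Max Z = n \<and> card Z \<in> {K + 1..2 * K - 1}"
      using cond(3) assms(3-5) by auto
  next
    assume R: "(card U \<ge> 1 \<and> Min U \<le> 3) \<and> Max Z = n \<and> card Z \<in> {K + 1..2 * K - 1}"
    \<comment> \<open>\<open>q = 0\<close> would give \<open>card Z = r < K\<close>, and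
      \<open>q \<ge> 2\<close> would give \<open>card Z \<ge> 2 * K\<close>; both leave the required
      range.\<close>
    have "q = 1"
    proof -
      have "q \<noteq> 0"
      proof
        assume "q = 0"
        then show False
          using assms(3-5) by simp
      qed
      moreover have "\<not> 2 \<le> q"
      proof
        assume "2 \<le> q"
        then have "2 * K \<le> q * K"
          by (rule mult_le_mono1)
        moreover have "card Z \<le> 2 * K - 1"
          using R by simp
        ultimately show False
          using assms(4,5) by linarith
      qed
      ultimately show ?thesis
        by simp
    qed
    moreover have "U \<noteq> {}"
      using R by (intro notI) simp
    then have "Min U \<in> vertices n - Z"
      using Min_in[OF finU] assms(6) by blast
    moreover have "n \<in> Z"
      using R Max_in[OF finZ neZ] by simp
    ultimately show "facet_defining (partition_polytope n K) (clique_sum Z) (clique_bound K q r)"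
      using conditions_imp_facet[OF n assms(1,2), of r "Min U"] R assms(3-5) by simp
  qed
qed

end
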